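(* For every integer $n\ge 2$, $$C^0_{L_n}=1+2\cos\Big(\frac{\pi}{n+1}\Big)\le C_{L_n}<3,$$ and moreover $C^0_{L_n}=C_{L_n}$ holds if and only if $2\le n\le 8$.
   Context: For $n\in\mathbb N$, $L_n$ is the path graph with vertex set $\{1,\dots,n\}$ and edges $\{j,j+1\}$, $1\le j\le n-1$, equipped with the graph (shortest path) distance $d$. A measure $\mu$ on a graph is a weight function $\mu:V\to(0,\infty)$, with $\mu(A)=\sum_{v\in A}\mu(v)$. Closed balls are $B(x,r)=\{y:d(x,y)\le r\}$. The doubling constant of $\mu$ is $C_\mu=\sup\{\mu(B(x,2k+1))/\mu(B(x,k)): x\in V,\ k\in\{0,1,2,\dots\}\}$ (equivalently, $\sup_{x,r>0}\mu(B^{o}(x,2r))/\mu(B^{o}(x,r))$ with open balls), and $\mu$ is doubling if $C_\mu<\infty$. The least doubling constant of a graph $G$ is $C_G=\inf\{C_\mu:\mu \text{ doubling on } G\}$. Also $C^0_\mu=\sup_{x\in V}\mu(B(x,1))/\mu(x)$ and $C^0_G=\inf_\mu C^0_\mu$. *)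

theory Defs
  imports Complex_Main
begin

text \<open>A finite graph is given by its vertex set V and its graph distance d.
  Measures are positive weight functions on V.\<close>

definition cball_g :: "'v set \<Rightarrow> ('v \<Rightarrow> 'v \<Rightarrow> nat) \<Rightarrow> 'v \<Rightarrow> nat \<Rightarrow> 'v set" where
  "cball_g V d x r = {y \<in> V. d x y \<le> r}"

definition is_measure :: "'v set \<Rightarrow> ('v \<Rightarrow> real) \<Rightarrow> bool" where
  "is_measure V \<mu> \<longleftrightarrow> (\<forall>v\<in>V. \<mu> v > 0)"

definition mu_set :: "('v \<Rightarrow> real) \<Rightarrow> 'v set \<Rightarrow> real" where
  "mu_set \<mu> A = (\<Sum>v\<in>A. \<mu> v)"

definition doubling_const :: "'v set \<Rightarrow> ('v \<Rightarrow> 'v \<Rightarrow> nat) \<Rightarrow> ('v \<Rightarrow> real) \<Rightarrow> real" where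
  "doubling_const V d \<mu> =
     Sup {mu_set \<mu> (cball_g V d x (2*k+1)) / mu_set \<mu> (cball_g V d x k) | x k. x \<in> V}"

definition doubling_const0 :: "'v set \<Rightarrow> ('v \<Rightarrow> 'v \<Rightarrow> nat) \<Rightarrow> ('v \<Rightarrow> real) \<Rightarrow> real" where
  "doubling_const0 V d \<mu> = Sup {mu_set \<mu> (cball_g V d x 1) / \<mu> x | x. x \<in> V}"

text \<open>Least doubling constants of the graph (infimum over all measures; on a finite
  graph every measure is doubling).\<close>
definition least_doubling_const :: "'v set \<Rightarrow> ('v \<Rightarrow> 'v \<Rightarrow> nat) \<Rightarrow> real" where
  "least_doubling_const V d = Inf {doubling_const V d \<mu> | \<mu>. is_measure V \<mu>}"

definition least_doubling_const0 :: "'v set \<Rightarrow> ('v \<Rightarrow> 'v \<Rightarrow> nat) \<Rightarrow> real" where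
  "least_doubling_const0 V d = Inf {doubling_const0 V d \<mu> | \<mu>. is_measure V \<mu>}"

text \<open>The path graph L_n: vertices 1..n, edges {j,j+1}; its shortest path distance
  is |i - j|.\<close>
definition path_V :: "nat \<Rightarrow> nat set" where
  "path_V n = {1..n}"

definition path_dist :: "nat \<Rightarrow> nat \<Rightarrow> nat" where
  "path_dist i j = nat \<bar>int i - int j\<bar>"

end

theory Submission
  imports Defs
begin

text \<open>
  Write \<open>t = pi / (n + 1)\<close>. The weight \<open>sin (j t)\<close> is the positive eigenvector, with eigenvalue
  \<open>L = 1 + 2 cos t\<close>, of the matrix that sends a weight to its sums over balls of radius 1.
  Pairing any other weight with it shows that \<open>L\<close> is the least value of the constant for radius 0.
  The constant weight has ratios at most 7/3 for radius \<open>k \<ge> 1\<close> and 3 for \<open>k = 0\<close>; a small concave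
  perturbation pushes the latter below 3.

  If \<open>C\<^sub>\<mu>\<close> is close to \<open>L\<close>, the same pairing forces \<open>\<mu>\<close> to be close to the eigenvector, so everything
  depends on whether the eigenvector has a ratio above \<open>L\<close>. The critical ball is the one with
  centre 1 and \<open>k = 1\<close>: there the ratio is at most \<open>L\<close> iff \<open>cos (3 t) \<le> 1/2\<close>, that is, iff \<open>n \<le> 8\<close>.
\<close>

subsection \<open>Doubling constants of finite graphs\<close>

lemma mu_set_cball_pos:
  assumes "finite V" "is_measure V \<mu>" "x \<in> V" "d x x = 0"
  shows "mu_set \<mu> (cball_g V d x r) > 0"
  unfolding mu_set_def
proof (rule sum_pos2)
  show "x \<in> cball_g V d x r" using assms by (simp add: cball_g_def)
qed (use assms in \<open>auto simp: cball_g_def is_measure_def less_imp_le\<close>)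

lemma mu_set_mono:
  assumes "finite V" "is_measure V \<mu>" "A \<subseteq> B" "B \<subseteq> V"
  shows "mu_set \<mu> A \<le> mu_set \<mu> B"
  unfolding mu_set_def
  by (rule sum_mono2) (use assms in \<open>auto simp: is_measure_def less_imp_le intro: finite_subset\<close>)

text \<open>A real \<open>Sup\<close> says something only about a bounded set. Every ball around
  \<open>x\<close> has mass between \<open>\<mu> x\<close> and the mass of \<open>V\<close>, so one
  bound serves all radii at once.\<close>

lemma bdd_above_cball_ratios:
  assumes "finite V" "is_measure V \<mu>" "\<And>x. x \<in> V \<Longrightarrow> d x x = 0"
  shows "bdd_above {mu_set \<mu> (cball_g V d x (f k)) / mu_set \<mu> (cball_g V d x (g k)) | x k. x \<in> V}"
proof -
  define M where "M = Max ((\<lambda>x. mu_set \<mu> V / \<mu> x) ` V)"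
  have "mu_set \<mu> (cball_g V d x (f k)) / mu_set \<mu> (cball_g V d x (g k)) \<le> M" if "x \<in> V" for x k
  proof -
    have "mu_set \<mu> {x} \<le> mu_set \<mu> (cball_g V d x (g k))"
      by (rule mu_set_mono[of V]) (use assms that in \<open>auto simp: cball_g_def\<close>)
    then have "\<mu> x \<le> mu_set \<mu> (cball_g V d x (g k))" by (simp add: mu_set_def)
    moreover have "mu_set \<mu> (cball_g V d x (f k)) \<le> mu_set \<mu> V"
      by (rule mu_set_mono[of V]) (use assms in \<open>auto simp: cball_g_def\<close>)
    moreover have "0 < \<mu> x" using assms(2) that by (auto simp: is_measure_def)
    moreover have "0 < mu_set \<mu> (cball_g V d x (f k))"
      by (rule mu_set_cball_pos) (use assms that in auto)
    ultimately have "mu_set \<mu> (cball_g V d x (f k)) / mu_set \<mu> (cball_g V d x (g k)) \<le> mu_set \<mu> V / \<mu> x"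
      by (intro frac_le) auto
    also have "\<dots> \<le> M" unfolding M_def using assms(1) that by (intro Max_ge) auto
    finally show ?thesis .
  qed
  then show ?thesis by (intro bdd_aboveI[of _ M]) auto
qed

lemma mu_set_cball_0:
  assumes "x \<in> V" "\<And>y. y \<in> V \<Longrightarrow> d x y = 0 \<longleftrightarrow> x = y"
  shows "mu_set \<mu> (cball_g V d x 0) = \<mu> x"
proof -
  have "cball_g V d x 0 = {x}" using assms by (auto simp: cball_g_def)
  then show ?thesis by (simp add: mu_set_def)
qed

text \<open>Together with \<open>doubling_const_le\<close>, this trades the supremum of quotients
  for division-free inequalities, the form used in all later arguments.\<close>

lemma mu_set_le_doubling_const:
  assumes "finite V" "is_measure V \<mu>" "\<And>x. x \<in> V \<Longrightarrow> d x x = 0" "x \<in> V"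
  shows "mu_set \<mu> (cball_g V d x (2*k+1)) \<le> doubling_const V d \<mu> * mu_set \<mu> (cball_g V d x k)"
proof -
  have "mu_set \<mu> (cball_g V d x (2*k+1)) / mu_set \<mu> (cball_g V d x k) \<le> doubling_const V d \<mu>"
    unfolding doubling_const_def
    by (rule cSup_upper[OF _ bdd_above_cball_ratios]) (use assms in auto)
  moreover have "0 < mu_set \<mu> (cball_g V d x k)"
    by (rule mu_set_cball_pos) (use assms in auto)
  ultimately show ?thesis by (simp add: pos_divide_le_eq)
qed

lemma doubling_const_le:
  assumes "finite V" "is_measure V \<mu>" "\<And>x. x \<in> V \<Longrightarrow> d x x = 0" "V \<noteq> {}"
    and "\<And>x k. x \<in> V \<Longrightarrow> mu_set \<mu> (cball_g V d x (2*k+1)) \<le> C * mu_set \<mu> (cball_g V d x k)"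
  shows "doubling_const V d \<mu> \<le> C"
  unfolding doubling_const_def
proof (rule cSup_least)
  fix r assume "r \<in> {mu_set \<mu> (cball_g V d x (2*k+1)) / mu_set \<mu> (cball_g V d x k) | x k. x \<in> V}"
  then obtain x k where r: "r = mu_set \<mu> (cball_g V d x (2*k+1)) / mu_set \<mu> (cball_g V d x k)" "x \<in> V"
    by auto
  have "0 < mu_set \<mu> (cball_g V d x k)"
    by (rule mu_set_cball_pos) (use assms r in auto)
  then show "r \<le> C" using assms(5)[OF r(2), of k] r(1) by (simp add: pos_divide_le_eq)
qed (use assms(4) in auto)

lemma mu_set_le_doubling_const0:
  assumes "finite V" "is_measure V \<mu>" "x \<in> V"
  shows "mu_set \<mu> (cball_g V d x 1) \<le> doubling_const0 V d \<mu> * \<mu> x"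
proof -
  have "{mu_set \<mu> (cball_g V d x 1) / \<mu> x | x. x \<in> V} = (\<lambda>x. mu_set \<mu> (cball_g V d x 1) / \<mu> x) ` V"
    by auto
  then have "bdd_above {mu_set \<mu> (cball_g V d x 1) / \<mu> x | x. x \<in> V}"
    using assms(1) by simp
  then have "mu_set \<mu> (cball_g V d x 1) / \<mu> x \<le> doubling_const0 V d \<mu>"
    unfolding doubling_const0_def by (intro cSup_upper) (use assms in auto)
  then show ?thesis using assms by (simp add: is_measure_def pos_divide_le_eq)
qed

lemma doubling_const0_le:
  assumes "is_measure V \<mu>" "V \<noteq> {}"
    and "\<And>x. x \<in> V \<Longrightarrow> mu_set \<mu> (cball_g V d x 1) \<le> C * \<mu> x"
  shows "doubling_const0 V d \<mu> \<le> C"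
  unfolding doubling_const0_def
  by (rule cSup_least) (use assms in \<open>auto simp: is_measure_def pos_divide_le_eq\<close>)

text \<open>A ball of radius 0 is a single vertex, so the ratios on the left are the case
  \<open>k = 0\<close> of those on the right.\<close>

lemma doubling_const0_le_doubling_const:
  assumes "finite V" "V \<noteq> {}" "is_measure V \<mu>"
    and "\<And>x y. x \<in> V \<Longrightarrow> y \<in> V \<Longrightarrow> d x y = 0 \<longleftrightarrow> x = y"
  shows "doubling_const0 V d \<mu> \<le> doubling_const V d \<mu>"
proof (rule doubling_const0_le)
  fix x assume x: "x \<in> V"
  have "mu_set \<mu> (cball_g V d x (2*0+1)) \<le> doubling_const V d \<mu> * mu_set \<mu> (cball_g V d x 0)"
    by (rule mu_set_le_doubling_const) (use assms x in auto)
  then show "mu_set \<mu> (cball_g V d x 1) \<le> doubling_const V d \<mu> * \<mu> x"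
    using x assms(4) by (simp add: mu_set_cball_0)
qed (use assms in auto)

text \<open>Bounds the constants of all measures below by 0, so that their infimum is a genuine
  lower bound.\<close>

lemma doubling_const0_nonneg:
  assumes "finite V" "V \<noteq> {}" "is_measure V \<mu>"
  shows "0 \<le> doubling_const0 V d \<mu>"
proof -
  obtain x where x: "x \<in> V" using assms(2) by auto
  have "0 \<le> mu_set \<mu> (cball_g V d x 1)"
    unfolding mu_set_def
    by (rule sum_nonneg) (use assms in \<open>auto simp: cball_g_def is_measure_def less_imp_le\<close>)
  also have "\<dots> \<le> doubling_const0 V d \<mu> * \<mu> x"
    by (rule mu_set_le_doubling_const0) (use assms x in auto)
  finally have "0 \<le> doubling_const0 V d \<mu> * \<mu> x" .
  moreover have "0 < \<mu> x" using assms(3) x by (simp add: is_measure_def)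
  ultimately show ?thesis by (simp add: zero_le_mult_iff)
qed

section \<open>Infimum over all measures\<close>

lemma is_measure_exists: "\<exists>\<mu>. is_measure V \<mu>"
  by (rule exI[of _ "\<lambda>_. 1"]) (simp add: is_measure_def)

lemma least_doubling_const0_le:
  assumes "finite V" "V \<noteq> {}" "is_measure V \<mu>"
  shows "least_doubling_const0 V d \<le> doubling_const0 V d \<mu>"
  unfolding least_doubling_const0_def
  by (rule cInf_lower) (use assms doubling_const0_nonneg in \<open>auto intro!: bdd_belowI[of _ 0]\<close>)

lemma least_doubling_const0_ge:
  assumes "\<And>\<mu>. is_measure V \<mu> \<Longrightarrow> C \<le> doubling_const0 V d \<mu>"
  shows "C \<le> least_doubling_const0 V d"
  unfolding least_doubling_const0_def
  by (rule cInf_greatest) (use assms is_measure_exists[of V] in auto)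

lemma least_doubling_const_le:
  assumes "finite V" "V \<noteq> {}" "is_measure V \<mu>"
    and "\<And>x y. x \<in> V \<Longrightarrow> y \<in> V \<Longrightarrow> d x y = 0 \<longleftrightarrow> x = y"
  shows "least_doubling_const V d \<le> doubling_const V d \<mu>"
  unfolding least_doubling_const_def
proof (rule cInf_lower)
  have "0 \<le> doubling_const V d \<nu>" if "is_measure V \<nu>" for \<nu>
    using doubling_const0_nonneg[OF assms(1,2) that]
      doubling_const0_le_doubling_const[OF assms(1,2) that assms(4)] by (rule order_trans)
  then show "bdd_below {doubling_const V d \<mu> | \<mu>. is_measure V \<mu>}"
    by (intro bdd_belowI[of _ 0]) auto
qed (use assms in auto)

lemma least_doubling_const_ge:
  assumes "\<And>\<mu>. is_measure V \<mu> \<Longrightarrow> C \<le> doubling_const V d \<mu>"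
  shows "C \<le> least_doubling_const V d"
  unfolding least_doubling_const_def
  by (rule cInf_greatest) (use assms is_measure_exists[of V] in auto)

lemma least_doubling_const0_le_least_doubling_const:
  assumes "finite V" "V \<noteq> {}"
    and "\<And>x y. x \<in> V \<Longrightarrow> y \<in> V \<Longrightarrow> d x y = 0 \<longleftrightarrow> x = y"
  shows "least_doubling_const0 V d \<le> least_doubling_const V d"
proof (rule least_doubling_const_ge)
  fix \<mu> assume "is_measure V \<mu>"
  then show "least_doubling_const0 V d \<le> doubling_const V d \<mu>"
    using least_doubling_const0_le[of V \<mu> d] doubling_const0_le_doubling_const[of V \<mu> d] assms by force
qed

subsection \<open>Path graphs\<close>

lemma path_dist_eq_0 [simp]: "path_dist x y = 0 \<longleftrightarrow> x = y"
  by (auto simp: path_dist_def)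

lemma finite_path_V [simp]: "finite (path_V n)"
  by (simp add: path_V_def)

lemma cball_path: "cball_g (path_V n) path_dist x r = {max 1 (x - r)..min n (x + r)}"
  by (auto simp: cball_g_def path_V_def path_dist_def)

lemma mu_set_cball_path_1:
  assumes "x \<in> path_V n"
  shows "mu_set \<mu> (cball_g (path_V n) path_dist x 1) =
    (if x - 1 \<in> path_V n then \<mu> (x - 1) else 0) + \<mu> x + (if x + 1 \<in> path_V n then \<mu> (x + 1) else 0)"
proof -
  have "cball_g (path_V n) path_dist x 1 = {x-1, x, x+1} \<inter> path_V n"
    using assms by (auto simp: cball_g_def path_V_def path_dist_def)
  moreover have "x - 1 \<noteq> x" using assms by (auto simp: path_V_def)
  ultimately show ?thesis
    using assms by (auto simp: mu_set_def Int_insert_left path_V_def)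
qed

section \<open>The sine eigenvector and the constant for radius 0\<close>

text \<open>Summation by parts: taking the sum of both neighbours is a symmetric operation, so
  interior terms cancel and only the two ends contribute.\<close>

lemma discrete_Green_identity:
  fixes s u :: "nat \<Rightarrow> real"
  shows "(\<Sum>j=1..n. s j * (u (j - 1) + u (j + 1))) - (\<Sum>j=1..n. u j * (s (j - 1) + s (j + 1)))
    = s n * u (Suc n) - s (Suc n) * u n + s 1 * u 0 - s 0 * u 1"
  by (induction n) (simp_all add: algebra_simps)

lemma sin_path_pos:
  assumes "j \<in> path_V n"
  shows "sin (real j * (pi / real (n + 1))) > 0"
proof (rule sin_gt_zero)
  show "0 < real j * (pi / real (n + 1))" using assms by (auto simp: path_V_def)
  have "real j < real (n + 1)" using assms by (auto simp: path_V_def)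
  then have "real j * pi < real (n+1) * pi" by (intro mult_strict_right_mono) auto
  then show "real j * (pi / real (n + 1)) < pi" by (simp add: field_simps)
qed

lemma sin_add_neighbours:
  assumes "1 \<le> j"
  shows "sin (real (j - 1) * t) + sin (real (j + 1) * t) = 2 * cos t * sin (real j * t)"
  using assms by (simp add: of_nat_diff algebra_simps sin_add sin_diff)

text \<open>All boundary terms of the Green identity vanish: the sine is 0 at \<open>0\<close> and
  \<open>n + 1\<close>, and \<open>u\<close> extends \<open>\<mu>\<close> by 0. The neighbour sum
  can then be moved onto the sine, where it is multiplication by \<open>2 * cos t\<close>.\<close>

lemma weighted_defect_sum:
  assumes "\<And>j. u j = (if j \<in> path_V n then \<mu> j else 0)" "t = pi / real (n + 1)"
  shows "(\<Sum>j=1..n. sin (real j * t) * (C * u j - mu_set \<mu> (cball_g (path_V n) path_dist j 1)))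
    = (C - (1 + 2 * cos t)) * (\<Sum>j=1..n. sin (real j * t) * u j)"
proof -
  let ?s = "\<lambda>j::nat. sin (real j * t)"
  have mu: "mu_set \<mu> (cball_g (path_V n) path_dist j 1) = u (j - 1) + u j + u (j + 1)" 
    if "j \<in> {1..n}" for j
    using that mu_set_cball_path_1[of j n \<mu>] by (simp add: assms(1) path_V_def)
  have s: "?s (Suc n) = 0" by (simp add: assms(2))
  have u: "u 0 = 0" "u (Suc n) = 0" by (simp_all add: assms(1) path_V_def)
  have "(\<Sum>j=1..n. ?s j * (u (j - 1) + u (j + 1))) = (\<Sum>j=1..n. u j * (?s (j - 1) + ?s (j + 1)))"
    using discrete_Green_identity[of ?s u n] s u by simp
  also have "\<dots> = (\<Sum>j=1..n. 2 * cos t * (?s j * u j))"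
    by (rule sum.cong[OF refl]) (subst sin_add_neighbours, auto)
  finally have "(\<Sum>j=1..n. ?s j * (u (j - 1) + u (j + 1))) = 2 * cos t * (\<Sum>j=1..n. ?s j * u j)"
    by (simp only: sum_distrib_left)
  moreover have "(\<Sum>j=1..n. ?s j * (C * u j - mu_set \<mu> (cball_g (path_V n) path_dist j 1)))
    = (\<Sum>j=1..n. (C - 1) * (?s j * u j) - ?s j * (u (j - 1) + u (j + 1)))"
    by (rule sum.cong[OF refl]) (subst mu, auto simp: algebra_simps)
  ultimately show ?thesis
    by (simp only: sum_subtractf sum_distrib_left[symmetric]) (simp add: algebra_simps)
qed

text \<open>With \<open>C\<close> the constant of \<open>\<mu>\<close>, every defect is nonnegative
  and every sine weight is positive, so the factor \<open>C - (1 + 2 * cos t)\<close> in the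
  weighted sum cannot be negative.\<close>

lemma doubling_const0_path_ge:
  assumes "n \<ge> 1" "is_measure (path_V n) \<mu>"
  shows "1 + 2 * cos (pi / real (n + 1)) \<le> doubling_const0 (path_V n) path_dist \<mu>"
proof -
  define t C where "t = pi / real (n + 1)" and "C = doubling_const0 (path_V n) path_dist \<mu>"
  define u where "u j = (if j \<in> path_V n then \<mu> j else 0)" for j
  have u: "u j > 0" if "j \<in> {1..n}" for j
    using that assms(2) by (simp add: u_def is_measure_def path_V_def)
  have s: "sin (real j * t) > 0" if "j \<in> {1..n}" for j
    using that sin_path_pos[of j n] by (simp add: t_def path_V_def)
  have "0 \<le> (\<Sum>j=1..n. sin (real j * t) * (C * u j - mu_set \<mu> (cball_g (path_V n) path_dist j 1)))"
  proof (rule sum_nonneg)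
    fix j assume j: "j \<in> {1..n}"
    then have "mu_set \<mu> (cball_g (path_V n) path_dist j 1) \<le> C * u j"
      using mu_set_le_doubling_const0[of "path_V n" \<mu> j path_dist] assms(2)
      by (simp add: u_def C_def path_V_def)
    then show "0 \<le> sin (real j * t) * (C * u j - mu_set \<mu> (cball_g (path_V n) path_dist j 1))"
      using s[OF j] by simp
  qed
  also have "\<dots> = (C - (1 + 2 * cos t)) * (\<Sum>j=1..n. sin (real j * t) * u j)"
    by (rule weighted_defect_sum) (auto simp: u_def t_def)
  finally have "0 \<le> (C - (1 + 2 * cos t)) * (\<Sum>j=1..n. sin (real j * t) * u j)" .
  moreover have "0 < (\<Sum>j=1..n. sin (real j * t) * u j)"
    by (rule sum_pos) (use u s assms(1) in auto)
  ultimately show ?thesis by (simp add: zero_le_mult_iff C_def t_def)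
qed

lemma is_measure_sin: "is_measure (path_V n) (\<lambda>j. sin (real j * (pi / real (n + 1))))"
  using sin_path_pos by (simp add: is_measure_def)

text \<open>At an end vertex the missing neighbour is \<open>0\<close> or \<open>n + 1\<close>,
  where the sine vanishes, so the interior recurrence holds there too.\<close>

lemma mu_set_sin_cball_1:
  assumes "x \<in> path_V n" "t = pi / real (n + 1)"
  shows "mu_set (\<lambda>j. sin (real j * t)) (cball_g (path_V n) path_dist x 1)
    = (1 + 2 * cos t) * sin (real x * t)"
proof -
  let ?\<mu> = "\<lambda>j::nat. sin (real j * t)"
  have "?\<mu> (x - 1) = 0" if "x - 1 \<notin> path_V n"
  proof -
    have "x - 1 = 0" using that assms(1) by (auto simp: path_V_def)
    then show ?thesis by simp
  qed
  moreover have "?\<mu> (x + 1) = 0" if "x + 1 \<notin> path_V n"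
  proof -
    have "x + 1 = n + 1" using that assms(1) by (auto simp: path_V_def)
    then show ?thesis by (simp only: assms(2)) simp
  qed
  ultimately have "mu_set ?\<mu> (cball_g (path_V n) path_dist x 1) = ?\<mu> (x - 1) + ?\<mu> x + ?\<mu> (x + 1)"
    by (subst mu_set_cball_path_1[OF assms(1)]) presburger
  also have "\<dots> = (1 + 2 * cos t) * ?\<mu> x"
    using sin_add_neighbours[of x t] assms(1) by (simp add: path_V_def algebra_simps)
  finally show ?thesis .
qed

lemma least_doubling_const0_path:
  assumes "n \<ge> 1"
  shows "least_doubling_const0 (path_V n) path_dist = 1 + 2 * cos (pi / real (n + 1))"
proof (rule antisym)
  define t where "t = pi / real (n + 1)"
  have m: "is_measure (path_V n) (\<lambda>j. sin (real j * t))" using is_measure_sin by (simp add: t_def)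
  have ne: "path_V n \<noteq> {}" using assms by (simp add: path_V_def)
  have "least_doubling_const0 (path_V n) path_dist
      \<le> doubling_const0 (path_V n) path_dist (\<lambda>j. sin (real j * t))"
    by (rule least_doubling_const0_le) (use m ne in auto)
  also have "\<dots> \<le> 1 + 2 * cos t"
    by (rule doubling_const0_le[OF m ne]) (simp only: mu_set_sin_cball_1[OF _ t_def] order_refl)
  finally show "least_doubling_const0 (path_V n) path_dist \<le> 1 + 2 * cos (pi / real (n + 1))"
    by (simp add: t_def)
  show "1 + 2 * cos (pi / real (n + 1)) \<le> least_doubling_const0 (path_V n) path_dist"
    by (rule least_doubling_const0_ge) (rule doubling_const0_path_ge[OF assms])
qed

subsection \<open>The upper bound 3\<close>

text \<open>The extreme case is a pair of balls clear of both ends, with ratio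
  \<open>(4*k+3) / (2*k+1)\<close>, which is at most 7/3 for \<open>k \<ge> 1\<close>. Clipping at
  an end never gives more.\<close>

lemma card_cball_path_le:
  assumes "x \<in> path_V n" "k \<ge> 1"
  shows "3 * card (cball_g (path_V n) path_dist x (2*k+1)) \<le> 7 * card (cball_g (path_V n) path_dist x k)"
  using assms unfolding cball_path by (simp only: path_V_def card_atLeastAtMost atLeastAtMost_iff) linarith

lemma least_doubling_const_path_less_3:
  assumes "n \<ge> 1"
  shows "least_doubling_const (path_V n) path_dist < 3"
proof -
  \<comment> \<open>This size keeps the perturbed weight between 1 and 9/8.\<close>
  define e where "e = 1 / (8 * real (n + 1) ^ 2)"
  define w where "w j = 1 + e * real j * (real (n + 1) - real j)" for j
  \<comment> \<open>The first entry serves \<open>k = 0\<close>: the second difference of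
    \<open>w\<close> is \<open>-2 * e\<close>, and \<open>2 * e\<close> is at least
    \<open>16 * e / 9 * w x\<close> since \<open>w x \<le> 9/8\<close>. The second serves
    \<open>k \<ge> 1\<close>: 21/8 is 7/3 times 9/8.\<close>
  define C where "C = max (3 - 16 * e / 9) (21/8)"
  have e: "0 < e" by (simp add: e_def)
  have w_lower: "1 \<le> w j" if "j \<le> n + 1" for j
    using that e by (auto simp: w_def intro!: mult_nonneg_nonneg)
  have w_upper: "w j \<le> 9/8" if "j \<le> n + 1" for j
  proof -
    have "real j * (real (n + 1) - real j) \<le> real (n + 1) * real (n + 1)"
      using that by (intro mult_mono) auto
    then have "e * (real j * (real (n + 1) - real j)) \<le> e * (real (n + 1) * real (n + 1))"
      using e by (intro mult_left_mono) auto
    also have "\<dots> = 1/8" by (simp add: e_def power2_eq_square)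
    finally show ?thesis by (simp add: w_def mult.assoc)
  qed
  have m: "is_measure (path_V n) w"
    unfolding is_measure_def
  proof
    fix v assume "v \<in> path_V n"
    then have "1 \<le> w v" by (intro w_lower) (simp add: path_V_def)
    then show "0 < w v" by simp
  qed
  have V: "path_V n \<noteq> {}" using assms by (simp add: path_V_def)
  have bound: "mu_set w (cball_g (path_V n) path_dist x (2*k+1)) \<le> C * mu_set w (cball_g (path_V n) path_dist x k)"
    if x: "x \<in> path_V n" for x k
  proof (cases "k = 0")
    case True
    have x': "1 \<le> x" "x \<le> n" using x by (auto simp: path_V_def)
    \<comment> \<open>A neighbour missing at an end is \<open>0\<close> or \<open>n + 1\<close>;
      \<open>w\<close> is positive there, so including it only enlarges the sum.\<close>
    have "mu_set w (cball_g (path_V n) path_dist x 1) \<le> w (x - 1) + w x + w (x + 1)"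
      using w_lower[of "x - 1"] w_lower[of "x + 1"] x'
      by (subst mu_set_cball_path_1[OF x]) force
    also have "\<dots> = 3 * w x - 2 * e"
      using x' by (simp add: w_def of_nat_diff algebra_simps)
    also have "\<dots> \<le> (3 - 16 * e / 9) * w x"
      using mult_left_mono[OF w_upper[of x], of "16 * e / 9"] e x' by (simp add: algebra_simps)
    also have "\<dots> \<le> C * w x"
      using w_lower[of x] x' by (intro mult_right_mono) (auto simp: C_def)
    finally show ?thesis using True x by (simp add: mu_set_cball_0)
  next
    case False
    let ?A = "cball_g (path_V n) path_dist x (2*k+1)" and ?B = "cball_g (path_V n) path_dist x k"
    have "mu_set w ?A \<le> real (card ?A) * (9/8)"
      unfolding mu_set_def by (rule sum_bounded_above, rule w_upper) (auto simp: cball_path)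
    also have "\<dots> \<le> 21/8 * real (card ?B)"
      using card_cball_path_le[OF x, of k] False by linarith
    also have "\<dots> \<le> 21/8 * mu_set w ?B"
    proof -
      have "real (card ?B) * 1 \<le> mu_set w ?B"
        unfolding mu_set_def by (rule sum_bounded_below, rule w_lower) (auto simp: cball_path)
      then show ?thesis by simp
    qed
    also have "\<dots> \<le> C * mu_set w ?B"
      using mu_set_cball_pos[OF finite_path_V m x, of path_dist k]
      by (intro mult_right_mono) (auto simp: C_def)
    finally show ?thesis .
  qed
  have "least_doubling_const (path_V n) path_dist \<le> doubling_const (path_V n) path_dist w"
    by (rule least_doubling_const_le) (use m V in auto)
  also have "\<dots> \<le> C" by (rule doubling_const_le) (use m V bound in auto)
  also have "\<dots> < 3" using e by (simp add: C_def)
  finally show ?thesis .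
qed

subsection \<open>Long paths\<close>

text \<open>By the triple angle formula the expression is \<open>2 * cos (3 * t) - 1\<close>, and
  \<open>3 * t < pi / 3\<close> holds exactly from \<open>n = 9\<close> on.\<close>

lemma cos_triple_gt_half:
  assumes "n \<ge> 9" "t = pi / real (n + 1)"
  shows "(2 * cos t) ^ 3 - 3 * (2 * cos t) - 1 > 0"
proof -
  have "9 * pi < real (n + 1) * pi" using assms(1) by (intro mult_strict_right_mono) auto
  then have "3 * t < pi / 3" by (simp add: assms(2) field_simps)
  then have "cos (pi / 3) < cos (3 * t)"
    using assms by (intro cos_monotone_0_pi) auto
  then have "1 / 2 < cos (3 * t)" by (simp add: cos_60)
  then show ?thesis by (simp add: cos_treble_cos power3_eq_cube)
qed

text \<open>An infimum may fail to be attained, so a gap uniform in \<open>\<mu>\<close> is needed. The defects \<open>e j\<close> of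
  \<open>\<mu>\<close> from the eigenvector recurrence are small compared with \<open>\<mu> 1\<close> when \<open>C\<^sub>\<mu>\<close> is close to the
  eigenvalue, because \<open>\<mu>\<close> grows at most by a factor 2 per step.\<close>

lemma doubling_const_path_gap:
  assumes n: "n \<ge> 9"
  shows "\<exists>\<delta>>0. \<forall>\<mu>. is_measure (path_V n) \<mu> \<longrightarrow>
    1 + 2 * cos (pi / real (n + 1)) + \<delta> \<le> doubling_const (path_V n) path_dist \<mu>"
proof -
  define t where "t = pi / real (n + 1)"
  define s where "s j = sin (real j * t)" for j
  define g where "g = (2 * cos t) ^ 3 - 3 * (2 * cos t) - 1"
  define m where "m = Min {s 1, s 2, s 3}"
  \<comment> \<open>Bounds the pairing of \<open>\<mu>\<close> with the sine in units of
    \<open>\<mu> 1\<close>: \<open>n\<close> terms, each at most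
    \<open>2 ^ n * \<mu> 1\<close>.\<close>
  define K where "K = real n * 2 ^ n"
  \<comment> \<open>The first entry forces \<open>C < 3\<close> and hence growth by at most a factor
    2; the second forces \<open>3 * (e 1 + e 2 + e 3) < g * u 1\<close>.\<close>
  define \<delta> where "\<delta> = min (2 - 2 * cos t) (g * m / (3 * K))"
  have s: "s j > 0" if "j \<in> {1..n}" for j
    using that sin_path_pos[of j n] by (simp add: s_def t_def path_V_def)
  have m: "m > 0" "m \<le> s 1" "m \<le> s 2" "m \<le> s 3"
    using n s by (auto simp: m_def)
  have g: "g > 0" unfolding g_def by (rule cos_triple_gt_half[OF n t_def])
  have K: "K > 0" using n by (simp add: K_def)
  have "3 * pi < real (n + 1) * pi" using n by (intro mult_strict_right_mono) auto
  then have t: "0 < t" "t < pi / 3" by (auto simp: t_def field_simps)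
  have "cos (pi / 3) < cos t" using t by (intro cos_monotone_0_pi) auto
  then have cos_gt: "1/2 < cos t" by (simp add: cos_60)
  have "cos t < cos 0" using t by (intro cos_monotone_0_pi) auto
  then have \<delta>: "\<delta> > 0" using g m K by (simp add: \<delta>_def)
  have "1 + 2 * cos t + \<delta> \<le> doubling_const (path_V n) path_dist \<mu>"
    if \<mu>: "is_measure (path_V n) \<mu>" for \<mu>
  proof (rule ccontr)
    define C where "C = doubling_const (path_V n) path_dist \<mu>"
    define c where "c = C - 1"
    \<comment> \<open>Extension by zero lets the recurrence hold at the end vertices as
      well.\<close>
    define u where "u j = (if j \<in> path_V n then \<mu> j else 0)" for j
    define e where "e j = C * u j - mu_set \<mu> (cball_g (path_V n) path_dist j 1)" for j
    assume "\<not> ?thesis"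
    then have lt: "C < 1 + 2 * cos t + \<delta>" by (simp add: C_def)
    then have "C < 3" by (simp add: \<delta>_def)
    have ratio: "mu_set \<mu> (cball_g (path_V n) path_dist x (2*k+1)) \<le> C * mu_set \<mu> (cball_g (path_V n) path_dist x k)"
      if "x \<in> path_V n" for x k
      unfolding C_def by (rule mu_set_le_doubling_const) (use \<mu> that in auto)
    have "1 + 2 * cos t \<le> C"
      unfolding C_def t_def
      by (rule order_trans[OF doubling_const0_path_ge doubling_const0_le_doubling_const])
        (use n \<mu> in \<open>auto simp: path_V_def\<close>)
    then have c: "2 * cos t \<le> c" "1 \<le> c" "c < 2" using \<open>C < 3\<close> cos_gt by (auto simp: c_def)
    have u: "u j > 0" if "j \<in> {1..n}" for j
      using that \<mu> by (simp add: u_def is_measure_def path_V_def)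
    have u_nonneg: "u j \<ge> 0" for j
      using \<mu> by (auto simp: u_def is_measure_def intro: less_imp_le)
    have ball: "mu_set \<mu> (cball_g (path_V n) path_dist j 1) = u (j - 1) + u j + u (j + 1)"
      if "j \<in> {1..n}" for j
      using that mu_set_cball_path_1[of j n \<mu>] by (simp add: u_def path_V_def)
    have e: "e j \<ge> 0" if "j \<in> {1..n}" for j
      using that ratio[of j 0] by (simp add: e_def mu_set_cball_0 u_def path_V_def)
    have growth: "u (Suc j) \<le> 2 ^ j * u 1" if "j < n" for j
      using that
    proof (induction j)
      case (Suc j)
      have "u (Suc (Suc j)) \<le> c * u (Suc j)"
        using e[of "Suc j"] ball[of "Suc j"] u_nonneg[of j] Suc.prems
        by (simp add: e_def c_def algebra_simps)
      also have "\<dots> \<le> 2 * u (Suc j)"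
        using c u_nonneg by (intro mult_right_mono) auto
      finally show ?case using Suc by simp
    qed simp
    have "(\<Sum>j=1..n. s j * u j) \<le> real (card {1..n}) * (2 ^ n * u 1)"
    proof (rule sum_bounded_above)
      fix j assume j: "j \<in> {1..n}"
      have "s j * u j \<le> 1 * u j" using u_nonneg by (intro mult_right_mono) (auto simp: s_def)
      also have "u j \<le> 2 ^ (j - 1) * u 1" using growth[of "j - 1"] j by (auto simp: Suc_diff_1)
      also have "\<dots> \<le> 2 ^ n * u 1" 
        using u_nonneg j by (intro mult_right_mono power_increasing) auto
      finally show "s j * u j \<le> 2 ^ n * u 1" by simp
    qed
    then have total: "(\<Sum>j=1..n. s j * u j) \<le> K * u 1" by (simp add: K_def)
    have "m * (e 1 + e 2 + e 3) \<le> s 1 * e 1 + s 2 * e 2 + s 3 * e 3"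
      using m e n by (simp only: distrib_left) (intro add_mono mult_right_mono, auto)
    also have "\<dots> = (\<Sum>j\<in>{1,2,3}. s j * e j)" by simp
    also have "\<dots> \<le> (\<Sum>j=1..n. s j * e j)"
      by (rule sum_mono2) (use n s e in \<open>auto intro!: mult_nonneg_nonneg intro: less_imp_le\<close>)
    also have "\<dots> = (C - (1 + 2 * cos t)) * (\<Sum>j=1..n. s j * u j)"
      unfolding s_def e_def by (rule weighted_defect_sum) (auto simp: u_def t_def)
    also have "\<dots> \<le> (C - (1 + 2 * cos t)) * (K * u 1)"
      using total c by (intro mult_left_mono) (auto simp: c_def)
    also have "\<dots> < \<delta> * (K * u 1)"
      using lt K u[of 1] n by (intro mult_strict_right_mono) auto
    also have "\<dots> \<le> g * m / (3 * K) * (K * u 1)"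
      using K u_nonneg[of 1] by (intro mult_right_mono) (auto simp: \<delta>_def)
    also have "\<dots> = m * (g * u 1 / 3)" using K by simp
    finally have small: "3 * (e 1 + e 2 + e 3) < g * u 1" using m by simp
    have u0: "u 0 = 0" by (simp add: u_def path_V_def)
    have rec: "u (j + 1) = c * u j - u (j - 1) - e j" if "j \<in> {1..n}" for j
      using ball[OF that] by (simp add: e_def c_def algebra_simps)
    have u2: "u 2 = c * u 1 - e 1" using rec[of 1] n u0 by (simp add: numeral_2_eq_2)
    have u3: "u 3 = c * u 2 - u 1 - e 2" using rec[of 2] n by simp
    have u4: "u 4 = c * u 3 - u 2 - e 3" using rec[of 3] n by simp
    \<comment> \<open>The critical ratio: around vertex 1 the balls of radius 3 and 1 are
      \<open>{1,2,3,4}\<close> and \<open>{1,2}\<close>.\<close>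
    have "u 1 + u 2 + u 3 + u 4 \<le> C * (u 1 + u 2)"
    proof -
      have "mu_set \<mu> (cball_g (path_V n) path_dist 1 (2*1+1)) = u 1 + u 2 + u 3 + u 4"
      proof -
        have "cball_g (path_V n) path_dist 1 (2*1+1) = {1,2,3,4}" using n by (auto simp: cball_path)
        then show ?thesis using n by (simp add: mu_set_def u_def path_V_def)
      qed
      moreover have "mu_set \<mu> (cball_g (path_V n) path_dist 1 1) = u 1 + u 2"
        using ball[of 1] n u0 by (simp add: numeral_2_eq_2)
      ultimately show ?thesis using ratio[of 1 1] n by (simp add: path_V_def)
    qed
    then have "u 3 + u 4 - c * (u 1 + u 2) \<le> 0" by (simp add: c_def algebra_simps)
    \<comment> \<open>Unrolling the recurrence from vertex 1 leaves a cubic in \<open>c\<close>,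
      whose value at \<open>2 * cos t\<close> is \<open>g\<close>, and an error whose coefficients
      are at most 3 because \<open>c < 2\<close>.\<close>
    moreover have "u 3 + u 4 - c * (u 1 + u 2)
        = (c ^ 3 - 3 * c - 1) * u 1 - ((c\<^sup>2 - 1) * e 1 + (1 + c) * e 2 + e 3)"
      by (simp add: u4 u3 u2 algebra_simps power2_eq_square power3_eq_cube)
    moreover have "(c\<^sup>2 - 1) * e 1 + (1 + c) * e 2 + e 3 \<le> 3 * (e 1 + e 2 + e 3)"
    proof -
      have "c\<^sup>2 \<le> 2\<^sup>2" using c by (intro power_mono) auto
      then have "(c\<^sup>2 - 1) * e 1 \<le> 3 * e 1" using e[of 1] n by (intro mult_right_mono) auto
      moreover have "(1 + c) * e 2 \<le> 3 * e 2" using e[of 2] n c by (intro mult_right_mono) auto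
      ultimately show ?thesis using e[of 3] n by simp
    qed
    moreover have "g * u 1 \<le> (c ^ 3 - 3 * c - 1) * u 1"
    proof -
      define b where "b = 2 * cos t"
      have b: "1 \<le> b" "b \<le> c" using cos_gt c by (auto simp: b_def)
      \<comment> \<open>The cubic increases from 1 on: this product is its difference quotient times
        \<open>c - b\<close>, with the quotient split into three nonnegative terms.\<close>
      have "0 \<le> (c - b) * ((c\<^sup>2 - 1) + (c * b - 1) + (b\<^sup>2 - 1))"
        using b c mult_mono[of 1 c 1 b]
        by (intro mult_nonneg_nonneg add_nonneg_nonneg) auto
      also have "\<dots> = (c ^ 3 - 3 * c - 1) - (b ^ 3 - 3 * b - 1)"
        by (simp add: algebra_simps power2_eq_square power3_eq_cube)
      finally show ?thesis
        using u_nonneg[of 1] by (intro mult_right_mono) (auto simp: g_def b_def)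
    qed
    ultimately show False using small by linarith
  qed
  then show ?thesis using \<delta> unfolding t_def by blast
qed

subsection \<open>Short paths\<close>

text \<open>Leaves finitely many radii to check: from \<open>k = 3\<close> on, the larger ball is
  replaced by the whole path and the smaller one by the ball of radius 3. For
  \<open>n \<le> 8\<close> a ball of radius 7 is the whole path, so nothing is lost at
  \<open>k = 3\<close>.\<close>

lemma doubling_const_path_le_check:
  assumes "is_measure (path_V n) \<mu>" "n \<ge> 1"
    and "\<And>x. x \<in> path_V n \<Longrightarrow> mu_set \<mu> (cball_g (path_V n) path_dist x 1) \<le> C * \<mu> x"
    and "\<And>x. x \<in> path_V n \<Longrightarrow>
      mu_set \<mu> (cball_g (path_V n) path_dist x 3) \<le> C * mu_set \<mu> (cball_g (path_V n) path_dist x 1)"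
    and "\<And>x. x \<in> path_V n \<Longrightarrow>
      mu_set \<mu> (cball_g (path_V n) path_dist x 5) \<le> C * mu_set \<mu> (cball_g (path_V n) path_dist x 2)"
    and "\<And>x. x \<in> path_V n \<Longrightarrow>
      mu_set \<mu> (path_V n) \<le> C * mu_set \<mu> (cball_g (path_V n) path_dist x 3)"
    and "C \<ge> 0"
  shows "doubling_const (path_V n) path_dist \<mu> \<le> C"
proof (rule doubling_const_le)
  fix x k :: nat assume x: "x \<in> path_V n"
  consider "k = 0" | "k = 1" | "k = 2" | "k \<ge> 3" by linarith
  then show "mu_set \<mu> (cball_g (path_V n) path_dist x (2*k+1)) \<le> C * mu_set \<mu> (cball_g (path_V n) path_dist x k)"
  proof cases
    case 1
    then show ?thesis using assms(3)[OF x] x by (simp add: mu_set_cball_0)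
  next
    case 2
    then show ?thesis using assms(4)[OF x] by simp
  next
    case 3
    then show ?thesis using assms(5)[OF x] by simp
  next
    case 4
    have "mu_set \<mu> (cball_g (path_V n) path_dist x (2*k+1)) \<le> mu_set \<mu> (path_V n)"
      by (rule mu_set_mono[of "path_V n"]) (use assms(1) in \<open>auto simp: cball_g_def\<close>)
    also have "\<dots> \<le> C * mu_set \<mu> (cball_g (path_V n) path_dist x 3)" by (rule assms(6)[OF x])
    also have "\<dots> \<le> C * mu_set \<mu> (cball_g (path_V n) path_dist x k)"
      by (intro mult_left_mono mu_set_mono[of "path_V n"]) (use assms(1,7) 4 in \<open>auto simp: cball_g_def\<close>)
    finally show ?thesis .
  qed
qed (use assms(1,2) in \<open>auto simp: path_V_def\<close>)

text \<open>Lets the simplifier write out sums over intervals with literal bounds, one term at a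
  time from the top.\<close>

lemma sum_atLeastAtMost_numeral:
  fixes f :: "nat \<Rightarrow> 'a::comm_monoid_add"
  shows "sum f {m..numeral k} =
    (if m \<le> numeral k then f (numeral k) + sum f {m..pred_numeral k} else 0)"
  by (simp add: numeral_eq_Suc sum.cl_ivl_Suc add.commute)

text \<open>The eigenvector equation turns every product \<open>C * v j\<close> into a sum, so the inequalities become
  linear in \<open>v\<close> with integer coefficients. Concavity settles all of them except the one for the end
  vertices and \<open>k = 1\<close>, which is \<open>v 4 \<le> v 1 + v 2\<close>, an equality when \<open>n = 8\<close>.\<close>

lemma short_path_check:
  fixes v :: "nat \<Rightarrow> real"
  assumes n: "n \<in> {2..8}"
    and nonneg: "\<And>j. j \<in> {1..n} \<Longrightarrow> 0 \<le> v j"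
    and sym: "\<And>j. j \<le> n + 1 \<Longrightarrow> v (n + 1 - j) = v j"
    and eig: "\<And>j. j \<in> {1..n} \<Longrightarrow> C * v j = v (j - 1) + v j + v (j + 1)"
    and concave: "\<And>j. j \<in> {1..n} \<Longrightarrow> v (j - 1) + v (j + 1) \<le> 2 * v j"
    and zero: "v 0 = 0" and four: "v 4 \<le> v 1 + v 2"
    and x: "x \<in> path_V n"
  shows "mu_set v (cball_g (path_V n) path_dist x 3) \<le> C * mu_set v (cball_g (path_V n) path_dist x 1)
    \<and> mu_set v (cball_g (path_V n) path_dist x 5) \<le> C * mu_set v (cball_g (path_V n) path_dist x 2)
    \<and> mu_set v (path_V n) \<le> C * mu_set v (cball_g (path_V n) path_dist x 3)"
proof -
  \<comment> \<open>For \<open>n \<le> 8\<close> the reflection expresses every \<open>v j\<close>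
    on the path through \<open>v 1\<close> to \<open>v 4\<close>, and \<open>v (n + 1)\<close>
    through \<open>v 0\<close>. Instances out of range simplify to trivial facts.\<close>
  note facts = sym[of 0] sym[of 1] sym[of 2] sym[of 3] sym[of 4] zero four
    concave[of 1] concave[of 2] concave[of 3] concave[of 4]
    nonneg[of 1] nonneg[of 2] nonneg[of 3] nonneg[of 4]
  note rules = sum_atLeastAtMost_numeral distrib_left eig numeral_2_eq_2[symmetric]
  consider "n = 2" | "n = 3" | "n = 4" | "n = 5" | "n = 6" | "n = 7" | "n = 8"
    using n by force
  then show ?thesis
  proof cases
    case 1
    have "x \<in> {1,2}" using x 1 by (auto simp: path_V_def)
    then show ?thesis
      unfolding mu_set_def cball_path unfolding 1 path_V_def
      by (elim insertE emptyE; simp add: rules 1; use facts[unfolded 1, simplified] in \<open>(intro conjI)?; linarith\<close>)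
  next
    case 2
    have "x \<in> {1,2,3}" using x 2 by (auto simp: path_V_def)
    then show ?thesis
      unfolding mu_set_def cball_path unfolding 2 path_V_def
      by (elim insertE emptyE; simp add: rules 2; use facts[unfolded 2, simplified] in \<open>(intro conjI)?; linarith\<close>)
  next
    case 3
    have "x \<in> {1,2,3,4}" using x 3 by (auto simp: path_V_def)
    then show ?thesis
      unfolding mu_set_def cball_path unfolding 3 path_V_def
      by (elim insertE emptyE; simp add: rules 3; use facts[unfolded 3, simplified] in \<open>(intro conjI)?; linarith\<close>)
  next
    case 4
    have "x \<in> {1,2,3,4,5}" using x 4 by (auto simp: path_V_def)
    then show ?thesis
      unfolding mu_set_def cball_path unfolding 4 path_V_def
      by (elim insertE emptyE; simp add: rules 4; use facts[unfolded 4, simplified] in \<open>(intro conjI)?; linarith\<close>)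
  next
    case 5
    have "x \<in> {1,2,3,4,5,6}" using x 5 by (auto simp: path_V_def)
    then show ?thesis
      unfolding mu_set_def cball_path unfolding 5 path_V_def
      by (elim insertE emptyE; simp add: rules 5; use facts[unfolded 5, simplified] in \<open>(intro conjI)?; linarith\<close>)
  next
    case 6
    have "x \<in> {1,2,3,4,5,6,7}" using x 6 by (auto simp: path_V_def)
    then show ?thesis
      unfolding mu_set_def cball_path unfolding 6 path_V_def
      by (elim insertE emptyE; simp add: rules 6; use facts[unfolded 6, simplified] in \<open>(intro conjI)?; linarith\<close>)
  next
    case 7
    have "x \<in> {1,2,3,4,5,6,7,8}" using x 7 by (auto simp: path_V_def)
    then show ?thesis
      unfolding mu_set_def cball_path unfolding 7 path_V_def
      by (elim insertE emptyE; simp add: rules 7; use facts[unfolded 7, simplified] in \<open>(intro conjI)?; linarith\<close>)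
  qed
qed

text \<open>The sine weight, optimal for radius 0, has no larger ratio at any other radius when the
  path is this short.\<close>

lemma least_doubling_const_path_short_le:
  assumes n: "n \<in> {2..8}"
  shows "least_doubling_const (path_V n) path_dist \<le> 1 + 2 * cos (pi / real (n + 1))"
proof -
  define t where "t = pi / real (n + 1)"
  define v where "v j = sin (real j * t)" for j
  let ?C = "1 + 2 * cos t"
  \<comment> \<open>The lower bound is where \<open>n \<le> 8\<close> enters: it gives
    \<open>3 * t \<ge> pi / 3\<close>. The upper bound keeps \<open>3 * t\<close> in the range where
    the cosine decreases.\<close>
  have t: "pi / 9 \<le> t" "t \<le> pi / 3"
    using n mult_right_mono[of "real (n + 1)" 9 pi] mult_right_mono[of 3 "real (n + 1)" pi]
    by (auto simp: t_def field_simps)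
  have m: "is_measure (path_V n) v"
    using is_measure_sin[of n] by (simp add: v_def[abs_def] t_def)
  have nonneg: "0 \<le> v j" if "j \<in> {1..n}" for j
    using m that by (auto simp: is_measure_def path_V_def intro: less_imp_le)
  have neighbours: "v (j - 1) + v (j + 1) = 2 * cos t * v j" if "j \<in> {1..n}" for j
    using that sin_add_neighbours[of j t] by (simp add: v_def)
  have sym: "v (n + 1 - j) = v j" if "j \<le> n + 1" for j
  proof -
    have "real (n + 1 - j) * t = pi - real j * t"
      using that by (simp add: t_def of_nat_diff field_simps)
    then show ?thesis by (simp only: v_def sin_pi_minus)
  qed
  have eig: "?C * v j = v (j - 1) + v j + v (j + 1)" if "j \<in> {1..n}" for j
    using neighbours[OF that] by (simp add: distrib_right)
  have concave: "v (j - 1) + v (j + 1) \<le> 2 * v j" if "j \<in> {1..n}" for j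
    using neighbours[OF that] nonneg[OF that] mult_right_mono[of "cos t" 1 "v j"] by simp
  \<comment> \<open>\<open>v\<close> is the sine at every natural number, so the identity for
    \<open>v 4 - v 2\<close> covers paths with fewer than four vertices too.\<close>
  have four: "v 4 \<le> v 1 + v 2"
  proof -
    have "cos (3 * t) \<le> cos (pi / 3)" using t by (intro cos_monotone_0_pi_le) auto
    then have "2 * cos (3 * t) * v 1 \<le> 1 * v 1"
      using n nonneg[of 1] by (intro mult_right_mono) (auto simp: cos_60)
    moreover have "v 4 - v 2 = 2 * cos (3 * t) * v 1"
      using sin_add[of "3 * t" t] sin_diff[of "3 * t" t] by (simp add: v_def)
    ultimately show ?thesis by simp
  qed
  have "0 \<le> cos t" using t by (intro cos_ge_zero) auto
  have "least_doubling_const (path_V n) path_dist \<le> doubling_const (path_V n) path_dist v"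
    by (rule least_doubling_const_le) (use m n in \<open>auto simp: path_V_def\<close>)
  also have "\<dots> \<le> ?C"
  proof (rule doubling_const_path_le_check[OF m])
    fix x assume "x \<in> path_V n"
    then show "mu_set v (cball_g (path_V n) path_dist x 1) \<le> ?C * v x"
      using mu_set_sin_cball_1[OF _ t_def, of x] by (simp add: v_def[abs_def])
  qed (use n \<open>0 \<le> cos t\<close> short_path_check[of n v ?C, OF n nonneg sym eig concave _ four] in
      \<open>auto simp: v_def\<close>)
  finally show ?thesis by (simp add: t_def)
qed

theorem theorem6p5:
  fixes n :: nat
  assumes "n \<ge> 2"
  shows "least_doubling_const0 (path_V n) path_dist = 1 + 2 * cos (pi / real (n + 1))
       \<and> least_doubling_const0 (path_V n) path_dist \<le> least_doubling_const (path_V n) path_dist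
       \<and> least_doubling_const (path_V n) path_dist < 3
       \<and> (least_doubling_const0 (path_V n) path_dist = least_doubling_const (path_V n) path_dist
            \<longleftrightarrow> n \<le> 8)"
proof (intro conjI)
  let ?D = "least_doubling_const0 (path_V n) path_dist"
  let ?L = "least_doubling_const (path_V n) path_dist"
  have ne: "path_V n \<noteq> {}" using assms by (simp add: path_V_def)
  show C0: "?D = 1 + 2 * cos (pi / real (n + 1))"
    by (rule least_doubling_const0_path) (use assms in simp)
  show le: "?D \<le> ?L"
    by (rule least_doubling_const0_le_least_doubling_const) (use ne in auto)
  show "?L < 3"
    by (rule least_doubling_const_path_less_3) (use assms in simp)
  show "?D = ?L \<longleftrightarrow> n \<le> 8"
  proof
    assume eq: "?D = ?L"
    show "n \<le> 8"
    proof (rule ccontr)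
      assume "\<not> n \<le> 8"
      then obtain \<delta> where \<delta>: "\<delta> > 0" "\<And>\<mu>. is_measure (path_V n) \<mu> \<Longrightarrow>
          1 + 2 * cos (pi / real (n + 1)) + \<delta> \<le> doubling_const (path_V n) path_dist \<mu>"
        using doubling_const_path_gap[of n] by auto
      \<comment> \<open>The gap is the same for all measures, so it survives the infimum.\<close>
      then have "1 + 2 * cos (pi / real (n + 1)) + \<delta> \<le> ?L"
        by (intro least_doubling_const_ge)
      with eq C0 \<delta>(1) show False by simp
    qed
  next
    assume "n \<le> 8"
    then show "?D = ?L"
      using least_doubling_const_path_short_le[of n] assms C0 le by simp
  qed
qed

end
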